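(* Let $f_1,\dots,f_m$ be quadratic polynomials on $\mathbb{R}^n$, written $f_i(x)=a_i+b_i^Tx+x^TF_ix$, and let $q(x)=c+d^Tx+x^TQx$ be a quadratic polynomial on $\mathbb{R}^n$. Let $T\subseteq\mathbb{R}^n$ be a nonempty set which is either $S(q)=\{x\in\mathbb{R}^n: q(x)\ge 0\}$ or $E(q)=\{x\in\mathbb{R}^n: q(x)=0\}$, and let $$V=\{(f_1(x),\dots,f_m(x)): x\in T\}\subset\mathbb{R}^m .$$ Let $\mathcal{W}_{in}$ be the set of all points $(a_1+b_1^Tx+F_1\bullet X,\ \dots,\ a_m+b_m^Tx+F_m\bullet X)\in\mathbb{R}^m$, where $x\in\mathbb{R}^n$ and $X$ is a real symmetric $n\times n$ matrix such that $$\begin{bmatrix}1&x^T\\ x&X\end{bmatrix}\succeq 0,\qquad c+d^Tx+Q\bullet X\ge 0,$$ and let $\mathcal{W}_{eq}$ be the set of all such points with the last inequality replaced by the equality $c+d^Tx+Q\bullet X=0$. Then: (i) Suppose $T=S(q)$. If $T$ is compact, then $\mathrm{conv}(V)=\mathcal{W}_{in}$; otherwise, $\overline{\mathrm{conv}(V)}=\overline{\mathcal{W}_{in}}$. (ii) Suppose $T=E(q)$. If $T$ is compact, then $\mathrm{conv}(V)=\mathcal{W}_{eq}$; otherwise, $\overline{\mathrm{conv}(V)}=\overline{\mathcal{W}_{eq}}$.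
   Context: Here $a_i,c\in\mathbb{R}$, $b_i,d\in\mathbb{R}^n$, and $F_i,Q$ are real symmetric $n\times n$ matrices. $A\bullet B=\mathrm{trace}(A^TB)$ is the Frobenius inner product of matrices; $M\succeq 0$ means that the symmetric matrix $M$ is positive semidefinite; $\mathrm{conv}(K)$ is the convex hull of $K$ and $\overline{K}$ its closure in Euclidean space.
   Formalization: In part (ii) the formal theorem assumes Q ≠ 0, i.e. q has degree exactly two; for affine q the claim can fail (n = m = 1, q(x) = x, f(x) = x²: conv(V) = {0} but W_eq = [0,∞)). *)

theory Defs
  imports "HOL-Analysis.Analysis"
begin

text \<open>\<open>Q = 0\<close> is allowed here: a polynomial of exact degree two is obtained by requiring \<open>Q \<noteq> 0\<close>.\<close>

definition quadratic :: "real \<Rightarrow> real^'n \<Rightarrow> real^'n^'n \<Rightarrow> real^'n \<Rightarrow> real" where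
  "quadratic c d Q x = c + d \<bullet> x + x \<bullet> (Q *v x)"

definition frobenius :: "real^'n^'n \<Rightarrow> real^'n^'n \<Rightarrow> real" where
  "frobenius A B = trace (transpose A ** B)"

definition symmetric_matrix :: "real^'n^'n \<Rightarrow> bool" where
  "symmetric_matrix M \<longleftrightarrow> transpose M = M"

definition psd :: "real^'n^'n \<Rightarrow> bool" where
  "psd M \<longleftrightarrow> symmetric_matrix M \<and> (\<forall>v. 0 \<le> v \<bullet> (M *v v))"

text \<open>The bordered matrix with rows \<open>(1, x\<^sup>T)\<close> and \<open>(x, X)\<close>. Its index type
  \<open>unit + 'n\<close> has \<open>n + 1\<close> elements; \<open>Inl ()\<close> is the border index.\<close>

definition bordered :: "real^'n \<Rightarrow> real^'n^'n \<Rightarrow> real^(unit + 'n)^(unit + 'n)" where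
  "bordered x X = (\<chi> i j. case (i, j) of
      (Inl _, Inl _) \<Rightarrow> 1
    | (Inl _, Inr l) \<Rightarrow> x $ l
    | (Inr k, Inl _) \<Rightarrow> x $ k
    | (Inr k, Inr l) \<Rightarrow> X $ k $ l)"

definition quad_lift :: "real \<Rightarrow> real^'n \<Rightarrow> real^'n^'n \<Rightarrow> real^'n \<Rightarrow> real^'n^'n \<Rightarrow> real" where
  "quad_lift c d Q x X = c + d \<bullet> x + frobenius Q X"

definition S_set :: "real \<Rightarrow> real^'n \<Rightarrow> real^'n^'n \<Rightarrow> (real^'n) set" where
  "S_set c d Q = {x. quadratic c d Q x \<ge> 0}"

definition E_set :: "real \<Rightarrow> real^'n \<Rightarrow> real^'n^'n \<Rightarrow> (real^'n) set" where
  "E_set c d Q = {x. quadratic c d Q x = 0}"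

definition V_set :: "('m \<Rightarrow> real) \<Rightarrow> ('m \<Rightarrow> real^'n) \<Rightarrow> ('m \<Rightarrow> real^'n^'n) \<Rightarrow> (real^'n) set
    \<Rightarrow> (real^'m) set" where
  "V_set a b F T = {\<chi> i. quadratic (a i) (b i) (F i) x | x. x \<in> T}"

definition W_in :: "('m \<Rightarrow> real) \<Rightarrow> ('m \<Rightarrow> real^'n) \<Rightarrow> ('m \<Rightarrow> real^'n^'n)
    \<Rightarrow> real \<Rightarrow> real^'n \<Rightarrow> real^'n^'n \<Rightarrow> (real^'m) set" where
  "W_in a b F c d Q = {\<chi> i. quad_lift (a i) (b i) (F i) x X | x X.
      symmetric_matrix X \<and> psd (bordered x X) \<and> quad_lift c d Q x X \<ge> 0}"

definition W_eq :: "('m \<Rightarrow> real) \<Rightarrow> ('m \<Rightarrow> real^'n) \<Rightarrow> ('m \<Rightarrow> real^'n^'n)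
    \<Rightarrow> real \<Rightarrow> real^'n \<Rightarrow> real^'n^'n \<Rightarrow> (real^'m) set" where
  "W_eq a b F c d Q = {\<chi> i. quad_lift (a i) (b i) (F i) x X | x X.
      symmetric_matrix X \<and> psd (bordered x X) \<and> quad_lift c d Q x X = 0}"

end

theory Submission
  imports Defs "HOL-Library.Multiset"
begin

text \<open>
  Homogenize: to \<open>c + d\<^sup>Tx + x\<^sup>TQx\<close> belongs the quadratic form
  \<open>h(t, z) = c t\<^sup>2 + t d\<^sup>Tz + z\<^sup>TQz\<close> on \<open>\<real> \<times> \<real>\<^sup>n\<close>, and \<open>h(t, tx) = t\<^sup>2 q(x)\<close>.
  A positive semidefinite bordered matrix is a finite sum of matrices \<open>y y\<^sup>T\<close> with \<open>y = (t, z)\<close>, so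
  that every lifted value \<open>quad_lift c d Q x X\<close> is the sum of the values \<open>h(y)\<close> over
  one and the same family of vectors (\<open>lift_as_sum_of_hforms\<close>).

  The family is not unique. Rotating two of its members in the plane that they span leaves
  the sum \<open>\<Sum> y y\<^sup>T\<close> unchanged, and if \<open>h\<close> has opposite signs at the two members, some rotation
  makes it vanish at one of them. Repeating this, all members satisfy the constraint that
  their sum satisfies: \<open>h \<ge> 0\<close> for each of them, or \<open>h = 0\<close> for each of them
  (\<open>sign_preserving_decomposition\<close>; the matrix form is due to Sturm and Zhang).

  A member \<open>(t, z)\<close> with \<open>t \<noteq> 0\<close> then stands for the point \<open>z / t\<close> of \<open>T\<close> with weight \<open>t\<^sup>2\<close>, and the
  weights add up to \<open>1\<close>. Were there only such members, the lifted point would be a convex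
  combination of points of \<open>V\<close>. A member \<open>(0, z)\<close> stands for a direction at infinity, and the
  point is that \<open>T\<close> really extends to infinity in that direction: \<open>(0, z)\<close> is a limit of
  vectors \<open>(t, tx)\<close> with \<open>x \<in> T\<close> (\<open>superlevel_cone_dense\<close>, \<open>level_cone_dense\<close>). If \<open>T\<close> is bounded this
  forces \<open>z = 0\<close>; in general it places the lifted point in the closure of \<open>conv V\<close>. The
  other inclusion holds because the lifted set is convex and contains \<open>V\<close> (take \<open>X = x x\<^sup>T\<close>).

  For level sets the hypothesis \<open>Q \<noteq> 0\<close> matters: on a hyperplane \<open>c + d\<^sup>Tx = 0\<close> every \<open>(0, z)\<close>
  satisfies \<open>h = 0\<close>, but only those with \<open>d\<^sup>Tz = 0\<close> are directions of \<open>T\<close>.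
\<close>

section \<open>Rank-one matrices and symmetric forms\<close>

definition outer :: "real^'n \<Rightarrow> real^'n^'n" where
  "outer z = (\<chi> i j. z $ i * z $ j)"

lemma frobenius_entries: "frobenius A B = (\<Sum>i\<in>UNIV. \<Sum>j\<in>UNIV. A $ i $ j * B $ i $ j)"
  unfolding frobenius_def trace_def matrix_matrix_mult_def transpose_def
  by (simp, rule sum.swap)

lemma frobenius_add: "frobenius G (A + B) = frobenius G A + frobenius G B"
  by (simp add: frobenius_entries distrib_left sum.distrib)

lemma frobenius_scaleR: "frobenius G (r *\<^sub>R A) = r * frobenius G A"
  by (simp add: frobenius_entries sum_distrib_left mult.left_commute)

lemma frobenius_zero: "frobenius G 0 = 0"
  by (simp add: frobenius_entries)

lemma frobenius_outer: "frobenius G (outer z) = z \<bullet> (G *v z)"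
  by (simp add: frobenius_entries outer_def inner_vec_def matrix_vector_mult_def
      sum_distrib_left ac_simps)

lemma outer_mult_vec: "outer z *v v = (z \<bullet> v) *\<^sub>R z"
  by (simp add: vec_eq_iff outer_def inner_vec_def matrix_vector_mult_def
      sum_distrib_left sum_distrib_right ac_simps)

lemma symmetric_outer: "symmetric_matrix (outer z)"
  by (simp add: symmetric_matrix_def outer_def transpose_def vec_eq_iff)

lemma symmetric_matrix_add:
  "symmetric_matrix A \<Longrightarrow> symmetric_matrix B \<Longrightarrow> symmetric_matrix (A + B)"
  by (simp add: symmetric_matrix_def transpose_def vec_eq_iff)

lemma symmetric_matrix_scaleR: "symmetric_matrix A \<Longrightarrow> symmetric_matrix (r *\<^sub>R A)"
  by (simp add: symmetric_matrix_def transpose_def vec_eq_iff)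

lemma symmetric_matrix_minus:
  "symmetric_matrix A \<Longrightarrow> symmetric_matrix B \<Longrightarrow> symmetric_matrix (A - B)"
  by (simp add: symmetric_matrix_def transpose_def vec_eq_iff)

lemma symmetric_matrix_inner:
  fixes A :: "real^'n^'n"
  assumes "symmetric_matrix A"
  shows "u \<bullet> (A *v v) = v \<bullet> (A *v u)"
  using assms by (metis symmetric_matrix_def dot_lmul_matrix inner_commute
      transpose_matrix_vector)

lemma scaleR_matrix_vector: "(r *\<^sub>R (A::real^'n^'n)) *v v = r *\<^sub>R (A *v v)"
  by (simp add: scaleR_matrix_vector_assoc)

text \<open>Polarization: the form \<open>v\<^sup>TAv\<close> determines a symmetric matrix.\<close>
lemma symmetric_matrix_form_nonzero:
  fixes A :: "real^'n^'n"
  assumes "symmetric_matrix A" "A \<noteq> 0"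
  obtains v where "v \<bullet> (A *v v) \<noteq> 0"
proof (rule ccontr)
  assume "\<not> thesis"
  then have z: "v \<bullet> (A *v v) = 0" for v using that by blast
  have "u \<bullet> (A *v v) = 0" for u v
    using z[of "u + v"] z[of u] z[of v] symmetric_matrix_inner[OF assms(1), of u v]
    by (simp add: matrix_vector_right_distrib inner_add_left inner_add_right)
  then have "A *v v = 0" for v by (metis inner_eq_zero_iff)
  then have "A = 0" by (metis matrix_eq matrix_vector_mult_0)
  then show False using assms(2) by simp
qed

text \<open>Deflation: if \<open>v\<^sup>TAv > 0\<close>, subtracting \<open>(Av)(Av)\<^sup>T / v\<^sup>TAv\<close> keeps the matrix positive
  semidefinite, keeps its kernel and adds \<open>v\<close> to the kernel. So the rank drops until the matrix
  is zero.\<close>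
lemma psd_sum_outer:
  fixes A :: "real^'n^'n"
  assumes "psd A"
  shows "\<exists>L. A = (\<Sum>z\<in>#L. outer z)"
  using assms
proof (induction "DIM(real^'n) - dim {u. A *v u = 0}" arbitrary: A rule: less_induct)
  case less
  show ?case
  proof (cases "A = 0")
    case True
    then show ?thesis by (intro exI[of _ "{#}"]) simp
  next
    case False
    have sym: "symmetric_matrix A" and pos: "\<And>v. 0 \<le> v \<bullet> (A *v v)"
      using less.prems by (auto simp: psd_def)
    obtain v where "v \<bullet> (A *v v) \<noteq> 0" using symmetric_matrix_form_nonzero[OF sym False] .
    then have k: "v \<bullet> (A *v v) > 0" using pos[of v] by simp
    define k where "k = v \<bullet> (A *v v)"
    define w where "w = (1 / sqrt k) *\<^sub>R (A *v v)"
    define A' where "A' = A - outer w"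
    have A'v: "A' *v u = A *v u - ((u \<bullet> (A *v v)) / k) *\<^sub>R (A *v v)" for u
      using k by (simp add: A'_def w_def matrix_vector_mult_diff_rdistrib outer_mult_vec
          k_def inner_commute)
    have "0 \<le> u \<bullet> (A' *v u)" for u
    proof -
      define r where "r = (u \<bullet> (A *v v)) / k"
      \<comment> \<open>The remaining form at \<open>u\<close> is the form of \<open>A\<close> at the \<open>A\<close>-orthogonal projection of \<open>u\<close> along \<open>v\<close>.\<close>
      have "(u - r *\<^sub>R v) \<bullet> (A *v (u - r *\<^sub>R v))
          = u \<bullet> (A *v u) - 2 * r * (u \<bullet> (A *v v)) + r * r * k"
        using symmetric_matrix_inner[OF sym, of v u]
        by (simp add: k_def matrix_vector_mult_diff_distrib matrix_vector_mult_scaleR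
            inner_diff_left inner_diff_right algebra_simps)
      also have "\<dots> = u \<bullet> (A' *v u)"
        using k unfolding A'v k_def[symmetric] by (simp add: r_def inner_diff_right)
      finally show ?thesis using pos by metis
    qed
    then have psd': "psd A'"
      using sym symmetric_outer by (auto simp: psd_def A'_def intro: symmetric_matrix_minus)
    have sub: "subspace {u. M *v u = 0}" for M :: "real^'n^'n"
      by (auto simp: subspace_def matrix_vector_right_distrib matrix_vector_mult_scaleR)
    have "{u. A *v u = 0} \<subset> {u. A' *v u = 0}"
    proof
      show "{u. A *v u = 0} \<subseteq> {u. A' *v u = 0}"
        using symmetric_matrix_inner[OF sym, of _ v] by (auto simp: A'v)
      have "A' *v v = 0" "A *v v \<noteq> 0" using k by (auto simp: A'v k_def)
      then show "{u. A *v u = 0} \<noteq> {u. A' *v u = 0}" by blast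
    qed
    then have "dim {u. A *v u = 0} < dim {u. A' *v u = 0}"
      by (intro dim_psubset) (simp add: span_eq_iff[THEN iffD2, OF sub])
    moreover have "dim {u. A' *v u = 0} \<le> DIM(real^'n)" by (rule dim_subset_UNIV)
    ultimately have "DIM(real^'n) - dim {u. A' *v u = 0} < DIM(real^'n) - dim {u. A *v u = 0}"
      by linarith
    then obtain L where "A' = (\<Sum>z\<in>#L. outer z)"
      using less.hyps[OF _ psd'] by blast
    then have "A = (\<Sum>z\<in>#add_mset w L. outer z)" by (simp add: A'_def algebra_simps)
    then show ?thesis by blast
  qed
qed

section \<open>Bordered matrices as sums of homogenized points\<close>

lemma bordered_form:
  fixes x u :: "real^'n" and t :: real
  defines "v \<equiv> (\<chi> i. case i of Inl _ \<Rightarrow> t | Inr k \<Rightarrow> u $ k)"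
  shows "v \<bullet> (bordered x X *v v) = t * t + 2 * t * (x \<bullet> u) + u \<bullet> (X *v u)"
proof -
  have plus: "sum g (UNIV :: (unit + 'n) set) = g (Inl ()) + (\<Sum>k\<in>UNIV. g (Inr k))"
    for g :: "unit + 'n \<Rightarrow> real"
    by (subst UNIV_Plus_UNIV[symmetric], subst sum.Plus) (auto simp: UNIV_unit)
  show ?thesis
    unfolding v_def inner_vec_def matrix_vector_mult_def bordered_def
    by (simp add: plus distrib_left sum.distrib sum_distrib_left algebra_simps)
qed

lemma psd_bordered_iff:
  fixes x :: "real^'n"
  shows "psd (bordered x X) \<longleftrightarrow>
    symmetric_matrix X \<and> (\<forall>t u. 0 \<le> t * t + 2 * t * (x \<bullet> u) + u \<bullet> (X *v u))"
proof -
  have sym: "symmetric_matrix (bordered x X) \<longleftrightarrow> symmetric_matrix X"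
    by (auto simp: symmetric_matrix_def bordered_def transpose_def vec_eq_iff split: sum.splits)
  have split: "w = (\<chi> i. case i of Inl _ \<Rightarrow> w $ Inl () | Inr k \<Rightarrow> (\<chi> k. w $ Inr k) $ k)"
    for w :: "real^(unit + 'n)"
    by (auto simp: vec_eq_iff split: sum.splits)
  show ?thesis
    unfolding psd_def sym by (metis bordered_form split)
qed

text \<open>The minimum of the bordered form over \<open>t\<close> is attained at \<open>t = - x\<^sup>Tu\<close> and is the form of \<open>X - x x\<^sup>T\<close>.\<close>
lemma psd_schur_complement:
  assumes "psd (bordered x X)"
  shows "psd (X - outer x)"
proof -
  have X: "symmetric_matrix X" "\<And>t u. 0 \<le> t * t + 2 * t * (x \<bullet> u) + u \<bullet> (X *v u)"
    using assms by (auto simp: psd_bordered_iff)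
  have "0 \<le> u \<bullet> ((X - outer x) *v u)" for u
    using X(2)[of "- (x \<bullet> u)" u]
    by (simp add: matrix_vector_mult_diff_rdistrib outer_mult_vec inner_diff_right inner_commute)
  then show ?thesis
    using X(1) symmetric_outer by (auto simp: psd_def intro: symmetric_matrix_minus)
qed

text \<open>A bilinear form whose diagonal is the homogenization of \<open>quadratic c d Q\<close>. Bilinearity is
  what makes the form behave well under rotations and displacements of its argument.\<close>
definition hform :: "real \<Rightarrow> real^'n \<Rightarrow> real^'n^'n \<Rightarrow> real \<times> (real^'n) \<Rightarrow> real \<times> (real^'n) \<Rightarrow> real"
  where "hform c d Q y w = c * fst y * fst w + fst y * (d \<bullet> snd w) + snd y \<bullet> (Q *v snd w)"

lemma bilinear_hform: "bilinear (hform c d Q)"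
  unfolding bilinear_def hform_def
  by (auto intro!: linearI simp: inner_add_left inner_add_right matrix_vector_right_distrib
      matrix_vector_mult_scaleR algebra_simps)

lemma continuous_on_hform: "continuous_on S (\<lambda>y. hform c d Q y y)"
  unfolding hform_def
  by (intro continuous_intros linear_continuous_on_compose[OF _ matrix_vector_mul_linear])

lemma hform_affine: "hform c d Q (t, t *\<^sub>R x) (t, t *\<^sub>R x) = t\<^sup>2 * quadratic c d Q x"
  by (simp add: hform_def quadratic_def matrix_vector_mult_scaleR power2_eq_square algebra_simps)

lemma lift_as_sum_of_hforms:
  assumes "psd (bordered x X)"
  obtains L where "\<And>c d G. quad_lift c d G x X = (\<Sum>y\<in>#L. hform c d G y y)"
proof -
  obtain L where L: "X - outer x = (\<Sum>z\<in>#L. outer z)"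
    using psd_sum_outer[OF psd_schur_complement[OF assms]] by blast
  have fr: "frobenius G (\<Sum>z\<in>#M. outer z) = (\<Sum>z\<in>#M. z \<bullet> (G *v z))" for G and M :: "(real^'n) multiset"
    by (induction M) (auto simp: frobenius_zero frobenius_add frobenius_outer)
  \<comment> \<open>The Schur complement supplies the vectors \<open>(0, z)\<close>, and the point \<open>x\<close> itself the vector \<open>(1, x)\<close>.\<close>
  have "quad_lift c d G x X
      = (\<Sum>y\<in>#add_mset (1, x) (image_mset (Pair 0) L). hform c d G y y)" for c d G
  proof -
    have "frobenius G X = frobenius G (outer x + (\<Sum>z\<in>#L. outer z))"
      using L by (metis add.commute diff_add_cancel)
    then show ?thesis
      by (simp add: quad_lift_def hform_def frobenius_add frobenius_outer fr
          image_mset.compositionality comp_def)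
  qed
  then show ?thesis using that by blast
qed

section \<open>Rotating a decomposition until the constraint holds termwise\<close>

lemma bilinear_diag_comb:
  assumes "bilinear B"
  shows "B (r *\<^sub>R y + s *\<^sub>R w) (r *\<^sub>R y + s *\<^sub>R w)
    = r\<^sup>2 * B y y + r * s * (B y w + B w y) + s\<^sup>2 * (B w w :: real)"
  by (simp add: bilinear_ladd[OF assms] bilinear_radd[OF assms] bilinear_lmul[OF assms]
      bilinear_rmul[OF assms] power2_eq_square algebra_simps)

text \<open>Along a quarter turn from \<open>y\<close> to \<open>w\<close> the form \<open>B\<close> changes sign, hence vanishes somewhere;
  the orthogonal companion \<open>w'\<close> compensates for every form \<open>D\<close> at once, because \<open>sin\<^sup>2 + cos\<^sup>2 = 1\<close>
  and the mixed terms cancel.\<close>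
lemma rotate_to_isotropic:
  fixes y w :: "'a::real_vector"
  assumes "bilinear B" and "B y y > 0" and "B w w < (0::real)"
  obtains y' w' where "B y' y' = 0"
    and "\<forall>D. bilinear D \<longrightarrow> D y' y' + D w' w' = D y y + (D w w :: real)"
proof -
  let ?y = "\<lambda>\<theta>. cos \<theta> *\<^sub>R y + sin \<theta> *\<^sub>R w"
  let ?w = "\<lambda>\<theta>. (- sin \<theta>) *\<^sub>R y + cos \<theta> *\<^sub>R w"
  have "\<exists>\<theta>\<ge>0. \<theta> \<le> pi / 2 \<and> B (?y \<theta>) (?y \<theta>) = 0"
    using assms by (intro IVT2') (auto simp: bilinear_diag_comb[OF assms(1)] intro!: continuous_intros)
  then obtain \<theta> where th: "B (?y \<theta>) (?y \<theta>) = 0" by blast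
  have "D (?y \<theta>) (?y \<theta>) + D (?w \<theta>) (?w \<theta>) = D y y + D w w"
    if "bilinear D" for D :: "'a \<Rightarrow> 'a \<Rightarrow> real"
  proof -
    have "D (?y \<theta>) (?y \<theta>) + D (?w \<theta>) (?w \<theta>)
      = ((sin \<theta>)\<^sup>2 + (cos \<theta>)\<^sup>2) * (D y y + D w w)"
      unfolding bilinear_diag_comb[OF that]
      by (simp only: power2_minus distrib_left distrib_right mult_minus_left mult_minus_right) simp
    then show ?thesis by simp
  qed
  with th show ?thesis using that by blast
qed

text \<open>Each rotation of a pair of opposite signs increases the number of vectors at which \<open>B\<close> vanishes,
  so the process stops with only one sign left.\<close>
lemma equisign_decomposition:
  fixes L :: "'a::real_vector multiset"
  assumes "bilinear B"
  shows "\<exists>L'. (\<forall>D. bilinear D \<longrightarrow> (\<Sum>y\<in>#L'. D y y) = (\<Sum>y\<in>#L. (D y y :: real)))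
    \<and> ((\<forall>y\<in>#L'. B y y \<ge> 0) \<or> (\<forall>y\<in>#L'. B y y \<le> (0::real)))"
proof (induction "size (filter_mset (\<lambda>y. B y y \<noteq> 0) L)" arbitrary: L rule: less_induct)
  case less
  show ?case
  proof (cases "(\<forall>y\<in>#L. B y y \<ge> 0) \<or> (\<forall>y\<in>#L. B y y \<le> 0)")
    case True
    then show ?thesis by blast
  next
    case False
    then obtain y w where y: "y \<in># L" "B y y > 0" and w: "w \<in># L" "B w w < 0"
      by (auto simp: not_le)
    then have "w \<in># L - {#y#}" by (metis insert_noteq_member insert_DiffM not_less_iff_gr_or_eq)
    then obtain M where L: "L = add_mset y (add_mset w M)"
      using y(1) by (metis insert_DiffM)
    obtain y' w' where y'w': "B y' y' = 0"
      "\<forall>D. bilinear D \<longrightarrow> D y' y' + D w' w' = D y y + (D w w :: real)"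
      by (rule rotate_to_isotropic[OF assms y(2) w(2)])
    define N where "N = add_mset y' (add_mset w' M)"
    have "size (filter_mset (\<lambda>y. B y y \<noteq> 0) N) < size (filter_mset (\<lambda>y. B y y \<noteq> 0) L)"
      using y(2) w(2) y'w'(1) by (simp add: N_def L)
    from less[OF this] obtain L' where
      L': "\<forall>D. bilinear D \<longrightarrow> (\<Sum>y\<in>#L'. D y y) = (\<Sum>y\<in>#N. (D y y :: real))"
        "(\<forall>y\<in>#L'. B y y \<ge> 0) \<or> (\<forall>y\<in>#L'. B y y \<le> 0)"
      by blast
    have "(\<Sum>y\<in>#N. D y y) = (\<Sum>y\<in>#L. (D y y :: real))" if "bilinear D" for D
      using y'w'(2) that by (simp add: N_def L)
    with L' show ?thesis by (intro exI[of _ L']) simp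
  qed
qed

lemma sum_mset_nonneg_eq_0:
  fixes f :: "'a \<Rightarrow> real"
  assumes "\<forall>y\<in>#L. f y \<ge> 0" "(\<Sum>y\<in>#L. f y) \<le> 0"
  shows "\<forall>y\<in>#L. f y = 0"
  using assms
proof (induction L)
  case (add z L)
  have "(\<Sum>y\<in>#L. f y) \<ge> 0" using add.prems(1) by (induction L) auto
  then have "f z = 0" and "(\<Sum>y\<in>#L. f y) \<le> 0" using add.prems by auto
  moreover have "\<forall>y\<in>#L. f y = 0"
    using add.prems(1) \<open>(\<Sum>y\<in>#L. f y) \<le> 0\<close> by (intro add.IH) auto
  ultimately show ?case by auto
qed simp

text \<open>Once all terms have one sign, the sum controls each of them: a vanishing sum, or a nonnegative sum
  of nonpositive terms, has only zero terms.\<close>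
lemma sign_preserving_decomposition:
  fixes L :: "'a::real_vector multiset"
  assumes "bilinear B" and J: "J = {0..} \<or> J = {0::real}" and "(\<Sum>y\<in>#L. B y y) \<in> J"
  obtains L' where "\<forall>D. bilinear D \<longrightarrow> (\<Sum>y\<in>#L'. D y y) = (\<Sum>y\<in>#L. (D y y :: real))"
    and "\<forall>y\<in>#L'. B y y \<in> J"
proof -
  obtain L' where L': "\<forall>D. bilinear D \<longrightarrow> (\<Sum>y\<in>#L'. D y y) = (\<Sum>y\<in>#L. (D y y :: real))"
    "(\<forall>y\<in>#L'. B y y \<ge> 0) \<or> (\<forall>y\<in>#L'. B y y \<le> 0)"
    using equisign_decomposition[OF assms(1), of L] by blast
  have sum: "(\<Sum>y\<in>#L'. B y y) \<in> J" using assms L'(1) by simp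
  have "\<forall>y\<in>#L'. B y y \<in> J"
    using L'(2)
  proof
    assume pos: "\<forall>y\<in>#L'. B y y \<ge> 0"
    show ?thesis
      using J
    proof
      assume "J = {0}"
      then have "\<forall>y\<in>#L'. B y y = 0" using pos sum by (intro sum_mset_nonneg_eq_0) auto
      then show ?thesis using \<open>J = {0}\<close> by simp
    qed (use pos in simp)
  next
    assume neg: "\<forall>y\<in>#L'. B y y \<le> 0"
    have "(\<Sum>y\<in>#L'. - B y y) = - (\<Sum>y\<in>#L'. B y y)" by (induction L') auto
    then have "\<forall>y\<in>#L'. - B y y = 0"
      using neg sum J by (intro sum_mset_nonneg_eq_0) auto
    then show ?thesis using J by auto
  qed
  with L'(1) show ?thesis by (rule that)
qed

section \<open>Homogenized sets and their directions at infinity\<close>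

text \<open>The homogenization of \<open>T\<close>, with negative \<open>t\<close> included: a quadratic form does not distinguish
  \<open>y\<close> from \<open>- y\<close>. The vectors \<open>(0, z)\<close> in its closure are the asymptotic directions of \<open>T\<close>.\<close>
definition cone_over :: "(real^'n) set \<Rightarrow> (real \<times> (real^'n)) set" where
  "cone_over T = {(t, t *\<^sub>R x) | t x. x \<in> T}"

lemma cone_over_memI:
  assumes "t \<noteq> 0" "(1 / t) *\<^sub>R z \<in> T"
  shows "(t, z) \<in> cone_over T"
  unfolding cone_over_def using assms by (intro CollectI exI[of _ t] exI[of _ "(1 / t) *\<^sub>R z"]) simp

lemma mem_cone_over_level_set:
  assumes "t \<noteq> 0" "hform c d Q (t, z) (t, z) \<in> J" "J = {0..} \<or> J = {0}"
  shows "(t, z) \<in> cone_over {x. quadratic c d Q x \<in> J}"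
proof -
  have "hform c d Q (t, z) (t, z) = t\<^sup>2 * quadratic c d Q ((1 / t) *\<^sub>R z)"
    using assms(1) hform_affine[of c d Q t "(1 / t) *\<^sub>R z"] by simp
  then have "quadratic c d Q ((1 / t) *\<^sub>R z) \<in> J"
    using assms by (auto simp: zero_le_mult_iff)
  then show ?thesis using assms(1) by (intro cone_over_memI) auto
qed

text \<open>If \<open>norm x \<le> R\<close> on \<open>T\<close>, the closed condition \<open>norm z \<le> R * \<bar>t\<bar>\<close> holds on the homogenization and
  passes to its closure.\<close>
lemma closure_cone_over_bounded:
  assumes "bounded T" "(0, z) \<in> closure (cone_over T)"
  shows "z = 0"
proof -
  obtain R where R: "\<And>x. x \<in> T \<Longrightarrow> norm x \<le> R" using assms(1) by (auto simp: bounded_iff)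
  have "closure (cone_over T) \<subseteq> {y. norm (snd y) \<le> R * \<bar>fst y\<bar>}"
  proof (rule closure_minimal)
    show "cone_over T \<subseteq> {y. norm (snd y) \<le> R * \<bar>fst y\<bar>}"
      using R by (auto simp: cone_over_def mult.commute[of R] intro!: mult_left_mono)
    show "closed {y::real \<times> (real^'n). norm (snd y) \<le> R * \<bar>fst y\<bar>}"
      by (intro closed_Collect_le continuous_intros)
  qed
  then show ?thesis using assms(2) by auto
qed

lemma hform_direction:
  assumes "symmetric_matrix Q"
  shows "hform c d Q (u, z + u *\<^sub>R x) (u, z + u *\<^sub>R x)
    = u\<^sup>2 * quadratic c d Q x + u * (d \<bullet> z + 2 * (x \<bullet> (Q *v z))) + z \<bullet> (Q *v z)"
  using symmetric_matrix_inner[OF assms, of z x]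
  by (simp add: hform_def quadratic_def matrix_vector_right_distrib matrix_vector_mult_scaleR
      inner_add_left inner_add_right power2_eq_square algebra_simps)

text \<open>In homogeneous coordinates the far points \<open>x + s z\<close> of a half-line are the vectors \<open>(u, z + u x)\<close>
  with \<open>u = 1 / s\<close>. The factor \<open>r\<close> selects the sign of \<open>s\<close>.\<close>
lemma direction_in_closure_cone_over:
  fixes z x :: "'a::real_normed_vector"
  assumes "r \<noteq> 0" and "\<And>u. u > 0 \<Longrightarrow> (u * r, z + (u * r) *\<^sub>R x) \<in> C"
  shows "(0, z) \<in> closure C"
proof -
  have "((\<lambda>u. (u * r, z + (u * r) *\<^sub>R x)) \<longlongrightarrow> (0 * r, z + (0 * r) *\<^sub>R x)) (at_right 0)"
    by (intro tendsto_Pair tendsto_add tendsto_scaleR tendsto_mult tendsto_const tendsto_ident_at)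
  moreover have "eventually (\<lambda>u. (u * r, z + (u * r) *\<^sub>R x) \<in> closure C) (at_right 0)"
    using eventually_at_right_less[of "0::real"]
    by eventually_elim (use assms(2) closure_subset[of C] in blast)
  ultimately have "(0 * r, z + (0 * r) *\<^sub>R x) \<in> closure C"
    by (rule Lim_in_closed_set[OF closed_closure, rotated 2]) simp
  then show ?thesis by simp
qed

text \<open>Starting from a point \<open>x\<close> of the set, \<open>q\<close> along the line in direction \<open>z\<close> is a parabola or an
  affine function with nonnegative leading coefficient \<open>z\<^sup>TQz\<close>. On the half-line on which its linear
  part is nonnegative, \<open>q\<close> stays nonnegative.\<close>
lemma superlevel_cone_dense:
  assumes sym: "symmetric_matrix Q" and x: "quadratic c d Q x \<ge> 0"
    and y: "hform c d Q y y \<ge> 0"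
  shows "y \<in> closure (cone_over {x. quadratic c d Q x \<in> {0..}})"
proof -
  obtain t z where tz: "y = (t, z)" by (cases y)
  show ?thesis
  proof (cases "t = 0")
    case False
    then show ?thesis
      using y closure_subset mem_cone_over_level_set[of t c d Q z "{0..}"] by (auto simp: tz)
  next
    case True
    \<comment> \<open>the linear coefficient of \<open>q\<close> along \<open>z\<close>, and the side on which it increases\<close>
    define l where "l = d \<bullet> z + 2 * (x \<bullet> (Q *v z))"
    define r where "r = (if l \<ge> 0 then 1 else -1 :: real)"
    have zz: "z \<bullet> (Q *v z) \<ge> 0" using y by (simp add: tz True hform_def)
    have "(u * r, z + (u * r) *\<^sub>R x) \<in> cone_over {x. quadratic c d Q x \<in> {0..}}" if "u > 0" for u
    proof (rule mem_cone_over_level_set)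
      have "u * r * l \<ge> 0" using that by (auto simp: r_def mult_nonneg_nonpos)
      then show "hform c d Q (u * r, z + (u * r) *\<^sub>R x) (u * r, z + (u * r) *\<^sub>R x) \<in> {0..}"
        using x zz by (simp add: hform_direction[OF sym] l_def)
    qed (use that in \<open>auto simp: r_def\<close>)
    then show ?thesis unfolding tz True
      by (intro direction_in_closure_cone_over[of r _ x]) (auto simp: r_def)
  qed
qed

text \<open>At an isotropic vector \<open>y\<close> with nonzero derivative in direction \<open>w\<close>, the form takes opposite signs
  at \<open>y \<plusminus> \<eta> w\<close> for small \<open>\<eta>\<close>. This persists under a small displacement in any direction \<open>v\<close>, and the
  intermediate value theorem yields an isotropic vector between the two displaced points. It is an
  elementary implicit function theorem, without control of \<open>\<delta>\<close> beyond smallness.\<close>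
lemma isotropic_perturbation:
  fixes y v w :: "'a::real_vector"
  assumes B: "bilinear B" and y: "B y y = (0::real)" and w: "B y w + B w y \<noteq> 0" and e: "e > 0"
  obtains \<epsilon> \<delta> where "0 < \<epsilon>" "\<epsilon> < e" "\<bar>\<delta>\<bar> < e"
    "B (y + \<epsilon> *\<^sub>R v + \<delta> *\<^sub>R w) (y + \<epsilon> *\<^sub>R v + \<delta> *\<^sub>R w) = 0"
proof -
  define h where "h = (\<lambda>\<epsilon> \<delta>. B (y + \<epsilon> *\<^sub>R v + \<delta> *\<^sub>R w) (y + \<epsilon> *\<^sub>R v + \<delta> *\<^sub>R w))"
  define \<beta> where "\<beta> = B y w + B w y"
  have h: "h \<epsilon> \<delta> = \<epsilon> * (B y v + B v y) + \<epsilon> * \<epsilon> * B v v + \<epsilon> * \<delta> * (B v w + B w v)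
      + \<delta> * \<beta> + \<delta> * \<delta> * B w w" for \<epsilon> \<delta>
    unfolding h_def \<beta>_def using y
    by (simp add: bilinear_ladd[OF B] bilinear_radd[OF B] bilinear_lmul[OF B]
        bilinear_rmul[OF B] algebra_simps)
  \<comment> \<open>small enough that the linear term \<open>\<delta> * \<beta>\<close> dominates \<open>\<delta>\<^sup>2 * B w w\<close> at \<open>\<delta> = \<plusminus>\<eta>\<close>\<close>
  define \<eta> where "\<eta> = min (e / 2) (\<bar>\<beta>\<bar> / (\<bar>B w w\<bar> + 1) / 2)"
  have b: "\<bar>\<beta>\<bar> > 0" using w by (simp add: \<beta>_def)
  then have \<eta>: "\<eta> > 0" "\<eta> < e" using e by (auto simp: \<eta>_def)
  have "\<eta> * \<bar>B w w\<bar> < \<bar>\<beta>\<bar>"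
  proof -
    have "\<eta> * (\<bar>B w w\<bar> + 1) \<le> \<bar>\<beta>\<bar> / (\<bar>B w w\<bar> + 1) / 2 * (\<bar>B w w\<bar> + 1)"
      by (intro mult_right_mono) (auto simp: \<eta>_def)
    also have "\<dots> = \<bar>\<beta>\<bar> / 2" by (simp add: field_simps add_eq_0_iff)
    finally show ?thesis using b \<eta>(1) by (simp add: distrib_left)
  qed
  then have "(\<eta> * B w w)\<^sup>2 < \<beta>\<^sup>2"
    using \<eta>(1) by (simp add: abs_le_square_iff[symmetric] abs_mult flip: not_le)
  then have "\<eta>\<^sup>2 * ((\<eta> * B w w)\<^sup>2 - \<beta>\<^sup>2) < 0" using \<eta>(1) by (simp add: mult_less_0_iff)
  also have "\<eta>\<^sup>2 * ((\<eta> * B w w)\<^sup>2 - \<beta>\<^sup>2) = h 0 \<eta> * h 0 (- \<eta>)"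
    by (simp add: h power2_eq_square algebra_simps)
  finally have neg0: "h 0 \<eta> * h 0 (- \<eta>) < 0" .
  have "((\<lambda>\<epsilon>. h \<epsilon> \<eta> * h \<epsilon> (- \<eta>)) \<longlongrightarrow> h 0 \<eta> * h 0 (- \<eta>)) (at_right 0)"
    unfolding h by (intro tendsto_intros)
  then have "eventually (\<lambda>\<epsilon>. h \<epsilon> \<eta> * h \<epsilon> (- \<eta>) < 0) (at_right 0)"
    using neg0 by (rule order_tendstoD)
  moreover have "eventually (\<lambda>\<epsilon>. 0 < \<epsilon> \<and> \<epsilon> < e) (at_right 0)"
    using e by (auto simp: eventually_at_right_field)
  ultimately have "eventually (\<lambda>\<epsilon>. h \<epsilon> \<eta> * h \<epsilon> (- \<eta>) < 0 \<and> 0 < \<epsilon> \<and> \<epsilon> < e) (at_right (0::real))"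
    by (rule eventually_conj)
  then obtain \<epsilon> where \<epsilon>: "h \<epsilon> \<eta> * h \<epsilon> (- \<eta>) < 0" "0 < \<epsilon>" "\<epsilon> < e"
    using eventually_happens'[of "at_right (0::real)"] by auto
  have cont: "continuous_on {- \<eta>..\<eta>} (h \<epsilon>)" unfolding h by (intro continuous_intros)
  have "\<exists>\<delta>. - \<eta> \<le> \<delta> \<and> \<delta> \<le> \<eta> \<and> h \<epsilon> \<delta> = 0"
  proof (cases "h \<epsilon> \<eta> > 0")
    case True
    then show ?thesis using \<epsilon>(1) \<eta> cont IVT'[of "h \<epsilon>" "- \<eta>" 0 \<eta>] by (auto simp: mult_less_0_iff)
  next
    case False
    then show ?thesis using \<epsilon>(1) \<eta> cont IVT2'[of "h \<epsilon>" \<eta> 0 "- \<eta>"] by (auto simp: mult_less_0_iff)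
  qed
  then obtain \<delta> where "\<bar>\<delta>\<bar> \<le> \<eta>" "h \<epsilon> \<delta> = 0" by (metis abs_le_iff minus_le_iff)
  then show ?thesis using that[of \<epsilon> \<delta>] \<epsilon> \<eta> by (auto simp: h_def)
qed

text \<open>The form in which the perturbation is applied: \<open>C\<close> is to be the part \<open>t \<noteq> 0\<close> of a quadric, and \<open>v\<close>
  is chosen so that displaced isotropic vectors leave the hyperplane \<open>t = 0\<close>.\<close>
lemma isotropic_closure:
  fixes y v w :: "'a::real_normed_vector"
  assumes B: "bilinear B" and y: "B y y = (0::real)" and w: "B y w + B w y \<noteq> 0"
    and C: "\<And>\<epsilon> \<delta>. \<epsilon> > 0 \<Longrightarrow> B (y + \<epsilon> *\<^sub>R v + \<delta> *\<^sub>R w) (y + \<epsilon> *\<^sub>R v + \<delta> *\<^sub>R w) = 0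
      \<Longrightarrow> y + \<epsilon> *\<^sub>R v + \<delta> *\<^sub>R w \<in> C"
  shows "y \<in> closure C"
  unfolding closure_approachable
proof (intro allI impI)
  fix e :: real assume "e > 0"
  define s where "s = norm v + norm w + 1"
  have s: "s > 0" unfolding s_def by (smt (verit) norm_ge_zero)
  then have "e / s > 0" using \<open>e > 0\<close> by simp
  then obtain \<epsilon> \<delta> where p: "0 < \<epsilon>" "\<epsilon> < e / s" "\<bar>\<delta>\<bar> < e / s"
    "B (y + \<epsilon> *\<^sub>R v + \<delta> *\<^sub>R w) (y + \<epsilon> *\<^sub>R v + \<delta> *\<^sub>R w) = 0"
    using isotropic_perturbation[where v = v, OF B y w] by metis
  have "dist (y + \<epsilon> *\<^sub>R v + \<delta> *\<^sub>R w) y = norm (\<epsilon> *\<^sub>R v + \<delta> *\<^sub>R w)" by (simp add: dist_norm)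
  also have "\<dots> \<le> \<epsilon> * norm v + \<bar>\<delta>\<bar> * norm w"
    using norm_triangle_ineq[of "\<epsilon> *\<^sub>R v" "\<delta> *\<^sub>R w"] p(1) by simp
  also have "\<dots> \<le> e / s * norm v + e / s * norm w"
    using p by (intro add_mono mult_right_mono) auto
  also have "\<dots> < e / s * s" using \<open>e / s > 0\<close> by (simp add: s_def distrib_left)
  also have "\<dots> = e" using s by simp
  finally show "\<exists>p\<in>C. dist p y < e" using C[OF p(1,4)] by blast
qed

text \<open>A vector \<open>(0, z)\<close> on the quadric \<open>h = 0\<close> must be approximated by vectors of the quadric with
  \<open>t \<noteq> 0\<close>. If \<open>Qz \<noteq> 0\<close>, increase \<open>t\<close> and correct along \<open>Qz\<close>. If \<open>Qz = 0\<close> but \<open>d\<^sup>Tz \<noteq> 0\<close>, the set is a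
  parabola-like graph in direction \<open>z\<close>: displace \<open>z\<close> by some \<open>v\<close> with \<open>v\<^sup>TQv \<noteq> 0\<close>, available since
  \<open>Q \<noteq> 0\<close>, and correct by \<open>t\<close>. If both vanish, the set contains with \<open>x\<close> the line
  through \<open>x\<close> in direction \<open>z\<close>.\<close>
lemma level_cone_dense:
  fixes Q :: "real^'n^'n"
  assumes sym: "symmetric_matrix Q" and Q: "Q \<noteq> 0" and x: "quadratic c d Q x = 0"
    and y: "hform c d Q y y = 0"
  shows "y \<in> closure (cone_over {x. quadratic c d Q x \<in> {0}})"
proof -
  let ?C = "cone_over {x. quadratic c d Q x \<in> {0}}"
  have C: "(t, z) \<in> ?C" if "t \<noteq> 0" "hform c d Q (t, z) (t, z) = 0" for t z
    using that by (intro mem_cone_over_level_set) auto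
  obtain t z where tz: "y = (t, z)" by (cases y)
  consider "t \<noteq> 0" | "t = 0" "Q *v z \<noteq> 0" | "t = 0" "Q *v z = 0" "d \<bullet> z \<noteq> 0"
    | "t = 0" "Q *v z = 0" "d \<bullet> z = 0" by blast
  then show ?thesis
  proof cases
    case 1
    then show ?thesis using C[of t z] y closure_subset tz by blast
  next
    case 2
    have "hform c d Q y (0, Q *v z) + hform c d Q (0, Q *v z) y \<noteq> 0"
      using 2 symmetric_matrix_inner[OF sym, of z "Q *v z"] by (simp add: tz hform_def)
    then show ?thesis
    proof (rule isotropic_closure[OF bilinear_hform y, where v = "(1, 0)"])
      fix \<epsilon> \<delta> :: real
      let ?p = "y + \<epsilon> *\<^sub>R (1, 0) + \<delta> *\<^sub>R (0, Q *v z)"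
      assume "\<epsilon> > 0" "hform c d Q ?p ?p = 0"
      then show "?p \<in> ?C" using C[of "fst ?p" "snd ?p"] 2 tz by simp
    qed
  next
    case 3
    obtain v where v: "v \<bullet> (Q *v v) \<noteq> 0" using symmetric_matrix_form_nonzero[OF sym Q] .
    have "hform c d Q y (1, 0) + hform c d Q (1, 0) y \<noteq> 0"
      using 3 by (simp add: tz hform_def)
    then show ?thesis
    proof (rule isotropic_closure[OF bilinear_hform y, where v = "(0, v)"])
      fix \<epsilon> \<delta> :: real
      let ?p = "y + \<epsilon> *\<^sub>R (0, v) + \<delta> *\<^sub>R (1, 0)"
      assume p: "\<epsilon> > 0" "hform c d Q ?p ?p = 0"
      \<comment> \<open>Without the correction the form would be \<open>\<epsilon>\<^sup>2 v\<^sup>TQv\<close>, which is not zero.\<close>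
      have "\<delta> \<noteq> 0"
      proof
        assume "\<delta> = 0"
        then have "hform c d Q ?p ?p = \<epsilon>\<^sup>2 * (v \<bullet> (Q *v v))"
          using 3 symmetric_matrix_inner[OF sym, of z v]
          by (simp add: tz hform_def matrix_vector_right_distrib matrix_vector_mult_scaleR
              inner_add_left inner_add_right power2_eq_square)
        then show False using p v by simp
      qed
      then show "?p \<in> ?C" using p(2) C[of "fst ?p" "snd ?p"] 3 tz by simp
    qed
  next
    case 4
    have "(u * 1, z + (u * 1) *\<^sub>R x) \<in> ?C" if "u > 0" for u
      using that 4 x by (intro C) (simp_all add: hform_direction[OF sym])
    then show ?thesis unfolding tz 4(1)
      by (intro direction_in_closure_cone_over[of 1 _ x]) auto
  qed
qed

section \<open>Convex cones and their slices\<close>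

lemma convex_cone_sum_mset:
  fixes K :: "'a::real_vector set"
  assumes "convex K" "cone K" "K \<noteq> {}" "\<And>y. y \<in># L \<Longrightarrow> g y \<in> K"
  shows "(\<Sum>y\<in>#L. g y) \<in> K"
  using assms(4)
proof (induction L)
  case empty
  then show ?case using assms cone_contains_0 by auto
next
  case (add y L)
  then show ?case using assms(1,2) convex_cone[of K] by auto
qed

lemma cone_hull_slice:
  assumes "(1::real, v) \<in> cone hull ({1} \<times> U)"
  shows "v \<in> U"
  using assms by (auto simp: cone_hull_expl)

text \<open>A sequence in the cone that converges to height \<open>1\<close> can be rescaled to height exactly \<open>1\<close>
  without changing its limit.\<close>
lemma closure_cone_hull_slice:
  fixes U :: "'a::real_normed_vector set"
  assumes "(1::real, v) \<in> closure (cone hull ({1} \<times> U))"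
  shows "v \<in> closure U"
proof -
  obtain p where p: "\<And>k. p k \<in> cone hull ({1::real} \<times> U)" "p \<longlonglongrightarrow> (1, v)"
    using assms by (auto simp: closure_sequential)
  have fst: "(\<lambda>k. fst (p k)) \<longlonglongrightarrow> 1" using tendsto_fst[OF p(2)] by simp
  have "(\<lambda>k. (1 / fst (p k)) *\<^sub>R snd (p k)) \<longlonglongrightarrow> (1 / 1) *\<^sub>R snd (1::real, v)"
    by (intro tendsto_intros fst tendsto_snd[OF p(2)]) simp
  moreover have "eventually (\<lambda>k. (1 / fst (p k)) *\<^sub>R snd (p k) \<in> closure U) sequentially"
    using order_tendstoD(1)[OF fst, of 0, simplified]
  proof eventually_elim
    case (elim k)
    obtain r u where "p k = r *\<^sub>R (1, u)" "u \<in> U" using p(1)[of k] by (auto simp: cone_hull_expl)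
    then show ?case using elim closure_subset by auto
  qed
  ultimately show ?thesis
    using Lim_in_closed_set[of "closure U" _ sequentially "v"] by simp
qed

section \<open>The lifted set\<close>

text \<open>A common form of \<^const>\<open>W_in\<close> (with \<open>J = {0..}\<close>) and \<^const>\<open>W_eq\<close> (with \<open>J = {0}\<close>).\<close>
definition lifted_image :: "('m \<Rightarrow> real) \<Rightarrow> ('m \<Rightarrow> real^'n) \<Rightarrow> ('m \<Rightarrow> real^'n^'n)
    \<Rightarrow> real \<Rightarrow> real^'n \<Rightarrow> real^'n^'n \<Rightarrow> real set \<Rightarrow> (real^'m) set" where
  "lifted_image a b F c d Q J = {\<chi> i. quad_lift (a i) (b i) (F i) x X | x X.
      psd (bordered x X) \<and> quad_lift c d Q x X \<in> J}"

lemma quad_lift_outer: "quad_lift c d Q x (outer x) = quadratic c d Q x"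
  by (simp add: quad_lift_def quadratic_def frobenius_outer)

lemma V_set_subset_lifted_image:
  "V_set a b F {x. quadratic c d Q x \<in> J} \<subseteq> lifted_image a b F c d Q J"
proof -
  have "psd (bordered x (outer x))" for x :: "real^'n"
  proof -
    have "t * t + 2 * t * (x \<bullet> u) + u \<bullet> (outer x *v u) = (t + x \<bullet> u)\<^sup>2" for t u
      by (simp add: outer_mult_vec power2_eq_square inner_commute algebra_simps)
    then show ?thesis by (simp add: psd_bordered_iff symmetric_outer)
  qed
  then show ?thesis
    by (auto simp: V_set_def lifted_image_def quad_lift_outer[symmetric])
qed

lemma convex_lifted_image:
  fixes b :: "'m::finite \<Rightarrow> real^'n"
  assumes "convex J"
  shows "convex (lifted_image a b F c d Q J)"
proof (rule convexI)
  fix p q and r s :: real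
  assume pq: "p \<in> lifted_image a b F c d Q J" "q \<in> lifted_image a b F c d Q J"
    and rs: "0 \<le> r" "0 \<le> s" "r + s = 1"
  obtain x X where x: "p = (\<chi> i. quad_lift (a i) (b i) (F i) x X)" "psd (bordered x X)"
    "quad_lift c d Q x X \<in> J" using pq(1) by (auto simp: lifted_image_def)
  obtain y Y where y: "q = (\<chi> i. quad_lift (a i) (b i) (F i) y Y)" "psd (bordered y Y)"
    "quad_lift c d Q y Y \<in> J" using pq(2) by (auto simp: lifted_image_def)
  let ?z = "r *\<^sub>R x + s *\<^sub>R y" and ?Z = "r *\<^sub>R X + s *\<^sub>R Y"
  have affine: "quad_lift c d Q ?z ?Z = r * quad_lift c d Q x X + s * quad_lift c d Q y Y"
    for c d and Q :: "real^'n^'n"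
  proof -
    have "c = r * c + s * c" using rs(3) by (metis distrib_right mult_1)
    then show ?thesis
      by (simp add: quad_lift_def frobenius_add frobenius_scaleR inner_add_right algebra_simps)
  qed
  have "psd (bordered ?z ?Z)"
    unfolding psd_bordered_iff
  proof (intro conjI allI)
    show "symmetric_matrix ?Z"
      using x(2) y(2) by (auto simp: psd_bordered_iff intro: symmetric_matrix_add symmetric_matrix_scaleR)
    fix t u
    have "t * t = r * (t * t) + s * (t * t)" using rs(3) by (metis distrib_right mult_1)
    then have "t * t + 2 * t * (?z \<bullet> u) + u \<bullet> (?Z *v u)
      = r * (t * t + 2 * t * (x \<bullet> u) + u \<bullet> (X *v u)) + s * (t * t + 2 * t * (y \<bullet> u) + u \<bullet> (Y *v u))"
      by (simp add: inner_add_left inner_add_right matrix_vector_mult_add_rdistrib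
          scaleR_matrix_vector algebra_simps)
    also have "\<dots> \<ge> 0" using x(2) y(2) rs by (auto simp: psd_bordered_iff)
    finally show "0 \<le> t * t + 2 * t * (?z \<bullet> u) + u \<bullet> (?Z *v u)" .
  qed
  moreover have "quad_lift c d Q ?z ?Z \<in> J"
    using convexD[OF assms x(3) y(3) rs] by (simp add: affine)
  moreover have "r *\<^sub>R p + s *\<^sub>R q = (\<chi> i. quad_lift (a i) (b i) (F i) ?z ?Z)"
    by (simp add: x(1) y(1) affine vec_eq_iff)
  ultimately show "r *\<^sub>R p + s *\<^sub>R q \<in> lifted_image a b F c d Q J"
    unfolding lifted_image_def by blast
qed

text \<open>The homogenization of \<open>x \<mapsto> (1, f x)\<close>. The first component \<open>t\<^sup>2\<close> is itself a homogenized
  quadratic, that of the constant \<open>1\<close>.\<close>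
definition hmap :: "('m \<Rightarrow> real) \<Rightarrow> ('m \<Rightarrow> real^'n) \<Rightarrow> ('m \<Rightarrow> real^'n^'n)
    \<Rightarrow> real \<times> (real^'n) \<Rightarrow> real \<times> (real^'m)" where
  "hmap a b F y = (hform 1 0 0 y y, \<chi> i. hform (a i) (b i) (F i) y y)"

lemma hmap_cone_over: "hmap a b F ` cone_over T \<subseteq> cone hull ({1} \<times> (convex hull V_set a b F T))"
proof (rule image_subsetI)
  fix y assume "y \<in> cone_over T"
  then obtain t x where x: "y = (t, t *\<^sub>R x)" "x \<in> T" by (auto simp: cone_over_def)
  let ?f = "\<chi> i. quadratic (a i) (b i) (F i) x"
  have "?f \<in> V_set a b F T" using x(2) by (auto simp: V_set_def)
  then have "(1, ?f) \<in> {1} \<times> (convex hull V_set a b F T)" by (simp add: hull_inc)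
  moreover have "hmap a b F y = t\<^sup>2 *\<^sub>R (1, ?f)"
    by (simp add: hmap_def x(1) hform_affine vec_eq_iff) (simp add: quadratic_def)
  ultimately show "hmap a b F y \<in> cone hull ({1} \<times> (convex hull V_set a b F T))"
    unfolding cone_hull_expl by (smt (verit) mem_Collect_eq zero_le_power2)
qed

lemma sum_mset_hmap:
  "(\<Sum>y\<in>#L. hmap a b F y)
    = (\<Sum>y\<in>#L. hform 1 0 0 y y, \<chi> i. \<Sum>y\<in>#L. hform (a i) (b i) (F i) y y)"
  by (induction L) (auto simp: hmap_def vec_eq_iff zero_prod_def)

text \<open>The lifted point is \<open>\<Sum> f(y)\<close> over vectors that satisfy the constraint one by one. The
  first component records that the weights \<open>t\<^sup>2\<close> add up to \<open>quad_lift 1 0 0 x X = 1\<close>.\<close>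
lemma lifted_image_decomposition:
  assumes "J = {0..} \<or> J = {0}" and "p \<in> lifted_image a b F c d Q J"
  obtains L where "(\<Sum>y\<in>#L. hmap a b F y) = (1, p)"
    and "\<And>y. y \<in># L \<Longrightarrow> hform c d Q y y \<in> J"
proof -
  obtain x X where x: "p = (\<chi> i. quad_lift (a i) (b i) (F i) x X)" "psd (bordered x X)"
    "quad_lift c d Q x X \<in> J" using assms(2) by (auto simp: lifted_image_def)
  obtain M where M: "\<And>c d G. quad_lift c d G x X = (\<Sum>y\<in>#M. hform c d G y y)"
    using lift_as_sum_of_hforms[OF x(2)] by metis
  have "(\<Sum>y\<in>#M. hform c d Q y y) \<in> J" using x(3) M by simp
  then obtain L where L: "\<forall>D. bilinear D \<longrightarrow> (\<Sum>y\<in>#L. D y y) = (\<Sum>y\<in>#M. (D y y :: real))"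
    "\<forall>y\<in>#L. hform c d Q y y \<in> J"
    by (rule sign_preserving_decomposition[OF bilinear_hform[of c d Q] assms(1)])
  have "(\<Sum>y\<in>#L. hform c d G y y) = quad_lift c d G x X" for c d G
    using L(1)[rule_format, OF bilinear_hform] M by simp
  moreover have "quad_lift 1 0 0 x X = 1"
    by (simp add: quad_lift_def frobenius_entries)
  ultimately have "(\<Sum>y\<in>#L. hmap a b F y) = (1, p)"
    by (simp add: sum_mset_hmap x(1))
  then show ?thesis using that L(2) by blast
qed

lemma continuous_on_hmap: "continuous_on S (hmap a b F)"
  unfolding hmap_def by (intro continuous_intros continuous_on_hform)

text \<open>By \<open>dense\<close> and continuity, \<open>hmap\<close> sends each vector of the decomposition into the closure of
  the convex cone over \<open>{1} \<times> conv V\<close>, so their sum lies there, and it has height \<open>1\<close>. For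
  compact \<open>T\<close> the vectors with \<open>t = 0\<close> vanish, and the others already lie in the homogenization of \<open>T\<close>, so the sum
  lies in the cone itself.\<close>
lemma hull_V_set_eq_lifted_image:
  fixes a :: "'m::finite \<Rightarrow> real"
  assumes J: "J = {0..} \<or> J = {0}" and T: "T = {x. quadratic c d Q x \<in> J}" and ne: "T \<noteq> {}"
    and dense: "\<And>y. hform c d Q y y \<in> J \<Longrightarrow> y \<in> closure (cone_over T)"
  shows "if compact T then convex hull (V_set a b F T) = lifted_image a b F c d Q J
    else closure (convex hull (V_set a b F T)) = closure (lifted_image a b F c d Q J)"
proof -
  let ?U = "convex hull (V_set a b F T)" and ?W = "lifted_image a b F c d Q J"
  let ?K = "cone hull ({1::real} \<times> ?U)"
  have "?U \<noteq> {}" using ne by (auto simp: V_set_def)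
  then have K: "convex ?K" "cone ?K" "?K \<noteq> {}"
    by (auto intro!: convex_cone_hull convex_Times simp: cone_cone_hull cone_hull_empty_iff[symmetric])
  have "convex J" using J by auto
  then have UW: "?U \<subseteq> ?W"
    unfolding T by (intro hull_minimal V_set_subset_lifted_image convex_lifted_image)
  have "?W \<subseteq> closure ?U"
  proof
    fix p assume "p \<in> ?W"
    then obtain L where L: "(\<Sum>y\<in>#L. hmap a b F y) = (1, p)"
      "\<And>y. y \<in># L \<Longrightarrow> hform c d Q y y \<in> J"
      using lifted_image_decomposition[OF J] by metis
    have "hmap a b F ` closure (cone_over T) \<subseteq> closure ?K"
      using hmap_cone_over[of a b F T] closure_subset
      by (intro image_closure_subset continuous_on_hmap) auto
    then have "hmap a b F y \<in> closure ?K" if "y \<in># L" for y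
      using dense[OF L(2)[OF that]] by blast
    moreover have "closure ?K \<noteq> {}" using K(3) by (simp add: closure_eq_empty)
    ultimately have "(\<Sum>y\<in>#L. hmap a b F y) \<in> closure ?K"
      using K(1,2) by (intro convex_cone_sum_mset convex_closure cone_closure) auto
    then show "p \<in> closure ?U" unfolding L(1) by (rule closure_cone_hull_slice)
  qed
  then have "closure ?U = closure ?W"
    using UW by (metis closure_closure closure_mono subset_antisym)
  moreover have "?U = ?W" if "compact T"
  proof
    show "?W \<subseteq> ?U"
    proof
      fix p assume "p \<in> ?W"
      then obtain L where L: "(\<Sum>y\<in>#L. hmap a b F y) = (1, p)"
        "\<And>y. y \<in># L \<Longrightarrow> hform c d Q y y \<in> J"
        using lifted_image_decomposition[OF J] by metis
      have "y \<in> cone_over T" if y: "y \<in># L" for y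
      proof (cases "fst y = 0")
        case True
        then have "snd y = 0"
          using closure_cone_over_bounded[OF compact_imp_bounded[OF \<open>compact T\<close>], of "snd y"]
            dense[OF L(2)[OF y]] by (metis prod.collapse)
        with True ne show ?thesis by (cases y) (auto simp: cone_over_def)
      next
        case False
        then show ?thesis
          unfolding T using mem_cone_over_level_set[of "fst y" c d Q "snd y"] L(2)[OF y] J by simp
      qed
      then have "(\<Sum>y\<in>#L. hmap a b F y) \<in> ?K"
        using hmap_cone_over[of a b F T] K by (intro convex_cone_sum_mset) auto
      then show "p \<in> ?U" unfolding L(1) by (rule cone_hull_slice)
    qed
  qed (rule UW)
  ultimately show ?thesis by simp
qed

section \<open>Convex hulls of quadratic images\<close>

theorem theorem2p1:
  fixes a :: "'m::finite \<Rightarrow> real"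
    and b :: "'m \<Rightarrow> real^'n"
    and F :: "'m \<Rightarrow> real^'n^'n"
    and c :: real
    and d :: "real^'n"
    and Q :: "real^'n^'n"
    and T :: "(real^'n) set"
  assumes "\<And>i. symmetric_matrix (F i)"
    and "symmetric_matrix Q"
    and "T \<noteq> {}"
    and "T = S_set c d Q \<or> T = E_set c d Q"
  shows "(T = S_set c d Q \<longrightarrow>
            (if compact T
             then convex hull (V_set a b F T) = W_in a b F c d Q
             else closure (convex hull (V_set a b F T)) = closure (W_in a b F c d Q)))
       \<and> (T = E_set c d Q \<and> Q \<noteq> 0 \<longrightarrow>
            (if compact T
             then convex hull (V_set a b F T) = W_eq a b F c d Q
             else closure (convex hull (V_set a b F T)) = closure (W_eq a b F c d Q)))"
proof (intro conjI impI)
  assume T: "T = S_set c d Q"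
  then have T': "T = {x. quadratic c d Q x \<in> {0..}}" by (simp add: S_set_def)
  obtain x where x: "quadratic c d Q x \<ge> 0" using assms(3) T' by auto
  have "W_in a b F c d Q = lifted_image a b F c d Q {0..}"
    by (auto simp: W_in_def lifted_image_def psd_bordered_iff)
  show "if compact T then convex hull (V_set a b F T) = W_in a b F c d Q
      else closure (convex hull (V_set a b F T)) = closure (W_in a b F c d Q)"
    unfolding \<open>W_in a b F c d Q = _\<close>
    by (rule hull_V_set_eq_lifted_image[OF _ T' assms(3)]) (use superlevel_cone_dense[OF assms(2) x] T' T in auto)
next
  assume T: "T = E_set c d Q \<and> Q \<noteq> 0"
  then have T': "T = {x. quadratic c d Q x \<in> {0}}" by (simp add: E_set_def)
  obtain x where x: "quadratic c d Q x = 0" using assms(3) T' by auto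
  have "W_eq a b F c d Q = lifted_image a b F c d Q {0}"
    by (auto simp: W_eq_def lifted_image_def psd_bordered_iff)
  show "if compact T then convex hull (V_set a b F T) = W_eq a b F c d Q
      else closure (convex hull (V_set a b F T)) = closure (W_eq a b F c d Q)"
    unfolding \<open>W_eq a b F c d Q = _\<close>
    by (rule hull_V_set_eq_lifted_image[OF _ T' assms(3)]) (use level_cone_dense[OF assms(2) _ x] T' T in auto)
qed

end
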